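(* The following identity holds, with the series converging: $$\frac{e-\frac1e}{2}=\sum_{m=1}^\infty\frac{(-1)^{m+1}}{(2m+1)!}\sum_{j=0}^{m-1}(-1)^j\binom{2m-j}{j}\pi^{2m-2j},$$ that is, $$\frac{e-\frac{1}{e}}{2}=\frac{\pi^2}{3!}-\frac{\pi^4-3\pi^2}{5!}+\frac{\pi^6-5\pi^4+6\pi^2}{7!}-\frac{\pi^8-7\pi^6+15\pi^4-10\pi^2}{9!}+\cdots.$$ *)

theory Defs
  imports Complex_Main
begin

definition series_term :: "nat \<Rightarrow> real" where
  "series_term m =
     (-1) ^ (m + 1) / fact (2 * m + 1) *
       (\<Sum>j = 0..<m. (-1) ^ j * real ((2 * m - j) choose j) * pi ^ (2 * m - 2 * j))"

end

theory Submission
  imports Defs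
begin

text \<open>
  Completed by its missing summand \<open>j = m\<close>, the inner sum is the term \<open>U\<^sub>2\<^sub>m\<^sub>+\<^sub>1(\<pi>, 1)\<close> of a Lucas
  sequence; the missing summands contribute \<open>\<Sum> 1/(2m+1)! = sinh 1\<close>. As \<open>\<pi> > 2\<close>, we can write
  \<open>\<pi> = a + b\<close> with real \<open>a \<noteq> b\<close> and \<open>a b = 1\<close>, so that Binet's formula gives
  \<open>U\<^sub>2\<^sub>m\<^sub>+\<^sub>1(\<pi>, 1) = (a\<^bsup>2m+1\<^esup> - b\<^bsup>2m+1\<^esup>)/(a - b)\<close>. The completed series is therefore
  \<open>(sin a - sin b)/(a - b)\<close>, which vanishes since \<open>b = \<pi> - a\<close>.
\<close>

fun lucas_U :: "'a::comm_ring_1 \<Rightarrow> 'a \<Rightarrow> nat \<Rightarrow> 'a" where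
  "lucas_U P Q 0 = 0"
| "lucas_U P Q (Suc 0) = 1"
| "lucas_U P Q (Suc (Suc n)) = P * lucas_U P Q (Suc n) - Q * lucas_U P Q n"

lemma lucas_U_binet: "(a - b) * lucas_U (a + b) (a * b) n = a ^ n - b ^ n"
proof (induction n rule: induct_nat_012)
  case (ge2 n)
  have "(a - b) * lucas_U (a + b) (a * b) (Suc (Suc n)) =
      (a + b) * ((a - b) * lucas_U (a + b) (a * b) (Suc n)) -
      a * b * ((a - b) * lucas_U (a + b) (a * b) n)"
    by (simp add: algebra_simps)
  also have "\<dots> = a ^ Suc (Suc n) - b ^ Suc (Suc n)"
    unfolding ge2.IH by (simp add: algebra_simps)
  finally show ?case .
qed simp_all

definition lucas_U_summand :: "'a::comm_ring_1 \<Rightarrow> 'a \<Rightarrow> nat \<Rightarrow> nat \<Rightarrow> 'a" where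
  "lucas_U_summand P Q n j = of_nat ((n - j) choose j) * P ^ (n - 2 * j) * (- Q) ^ j"

lemma lucas_U_summand_0: "lucas_U_summand P Q n 0 = P ^ n"
  by (simp add: lucas_U_summand_def)

lemma lucas_U_summand_eq_0: "n < 2 * j \<Longrightarrow> lucas_U_summand P Q n j = 0"
  by (simp add: lucas_U_summand_def binomial_eq_0)

lemma lucas_U_summand_Suc_Suc:
  "lucas_U_summand P Q (Suc (Suc n)) (Suc j) =
    P * lucas_U_summand P Q (Suc n) (Suc j) - Q * lucas_U_summand P Q n j"
proof -
  consider (inside) "2 * j < n" | (boundary) "n = 2 * j" | (outside) "n < 2 * j"
    by linarith
  then show ?thesis
  proof cases
    case inside
    then have pascal: "(Suc n - j) choose Suc j = ((n - j) choose j) + ((n - j) choose Suc j)"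
      by (simp add: Suc_diff_le)
    have "n - 2 * j = Suc (Suc n - 2 * Suc j)"
      using inside by simp
    then have "P ^ (n - 2 * j) = P * P ^ (Suc n - 2 * Suc j)"
      by (simp only: power_Suc)
    then show ?thesis
      by (simp add: lucas_U_summand_def pascal algebra_simps)
  next
    case boundary
    then show ?thesis
      by (simp add: lucas_U_summand_def binomial_eq_0)
  next
    case outside
    then show ?thesis
      by (simp add: lucas_U_summand_eq_0)
  qed
qed

lemma lucas_U_Suc_eq_sum:
  "n div 2 \<le> N \<Longrightarrow> lucas_U P Q (Suc n) = (\<Sum>j\<le>N. lucas_U_summand P Q n j)"
proof (induction n arbitrary: N rule: induct_nat_012)
  case (ge2 n)
  then obtain K where N: "N = Suc K" and K: "n div 2 \<le> K"
    by (cases N) auto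
  have "(\<Sum>j\<le>N. lucas_U_summand P Q (Suc (Suc n)) j) =
      P * (\<Sum>j\<le>N. lucas_U_summand P Q (Suc n) j) - Q * (\<Sum>j\<le>K. lucas_U_summand P Q n j)"
    unfolding N sum.atMost_Suc_shift
    by (simp add: lucas_U_summand_0 lucas_U_summand_Suc_Suc sum_subtractf sum_distrib_left
        distrib_left)
  also have "\<dots> = P * lucas_U P Q (Suc (Suc n)) - Q * lucas_U P Q (Suc n)"
    using ge2.IH(1) [OF K] ge2.IH(2) [of N] K N by simp
  finally show ?case by simp
qed (simp_all add: sum.atMost_shift lucas_U_summand_0 lucas_U_summand_eq_0)

lemma sinh_paired:
  fixes x :: "'a::{real_normed_field, banach}"
  shows "(\<lambda>n. x ^ (2 * n + 1) / fact (2 * n + 1)) sums sinh x"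
proof -
  let ?f = "\<lambda>n. if even n then 0 else x ^ n /\<^sub>R fact n"
  have "?f n = 0" if "n \<notin> range (\<lambda>k. 2 * k + 1)" for n
    using that by (auto elim: oddE)
  then have "(\<lambda>n. ?f (2 * n + 1)) sums sinh x"
    using sinh_converges [of x]
    by (subst sums_mono_reindex [where f = ?f]) (auto simp: strict_mono_def)
  then show ?thesis
    by (simp add: scaleR_conv_of_real divide_inverse mult.commute del: fact_Suc)
qed

lemma lucas_U_sums_sin_diff:
  fixes a b :: real
  assumes "a \<noteq> b"
  shows "(\<lambda>m. (- 1) ^ m / fact (2 * m + 1) * lucas_U (a + b) (a * b) (2 * m + 1))
    sums ((sin a - sin b) / (a - b))"
proof -
  have "lucas_U (a + b) (a * b) n = (a ^ n - b ^ n) / (a - b)" for n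
    using lucas_U_binet [of a b n] assms by (simp add: field_simps)
  moreover have "(\<lambda>m. ((- 1) ^ m / fact (2 * m + 1) * a ^ (2 * m + 1) -
      (- 1) ^ m / fact (2 * m + 1) * b ^ (2 * m + 1)) / (a - b)) sums ((sin a - sin b) / (a - b))"
    by (intro sums_divide sums_diff sin_paired)
  ultimately show ?thesis
    by (simp add: right_diff_distrib del: fact_Suc)
qed

lemma sum_prod_distinctE:
  fixes s p :: real
  assumes "4 * p < s\<^sup>2"
  obtains a b where "a \<noteq> b" "a + b = s" "a * b = p"
proof
  let ?d = "sqrt (s\<^sup>2 - 4 * p)"
  show "(s + ?d) / 2 \<noteq> (s - ?d) / 2" "(s + ?d) / 2 + (s - ?d) / 2 = s"
    using assms by (simp_all add: field_simps)
  have "(s + ?d) / 2 * ((s - ?d) / 2) = (s\<^sup>2 - ?d\<^sup>2) / 4"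
    by (simp add: field_simps power2_eq_square)
  also have "\<dots> = p"
    using assms by simp
  finally show "(s + ?d) / 2 * ((s - ?d) / 2) = p" .
qed

lemma lucas_U_pi_sums_0:
  assumes "4 * Q < pi\<^sup>2"
  shows "(\<lambda>m. (- 1) ^ m / fact (2 * m + 1) * lucas_U pi Q (2 * m + 1)) sums 0"
proof -
  obtain a b where ab: "a \<noteq> b" "a + b = pi" "a * b = Q"
    using assms by (rule sum_prod_distinctE)
  have "sin b = sin a"
    using sin_pi_minus [of a] unfolding ab(2) [symmetric] by simp
  then show ?thesis
    using lucas_U_sums_sin_diff [OF ab(1)] by (simp only: ab diff_self div_0)
qed

lemma pi_ge_three: "3 \<le> pi"
  using sin_x_le_x [of "pi / 6"] by (simp add: sin_30)

lemma series_term_eq: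
  "series_term m = 1 / fact (2 * m + 1) - (- 1) ^ m / fact (2 * m + 1) * lucas_U pi 1 (2 * m + 1)"
proof -
  have "lucas_U pi 1 (2 * m + 1) = (\<Sum>j\<le>m. lucas_U_summand pi 1 (2 * m) j)"
    using lucas_U_Suc_eq_sum [of "2 * m" m pi 1] by simp
  also have "\<dots> =
      (\<Sum>j = 0..<m. (- 1) ^ j * real ((2 * m - j) choose j) * pi ^ (2 * m - 2 * j)) + (- 1) ^ m"
    by (simp add: lucas_U_summand_def mult_ac atLeast0LessThan flip: lessThan_Suc_atMost)
  finally have "series_term m =
      (- 1) ^ (m + 1) / fact (2 * m + 1) * (lucas_U pi 1 (2 * m + 1) - (- 1) ^ m)"
    by (simp only: series_term_def add_diff_cancel_right')
  also have "\<dots> = ((- 1) ^ m * (- 1) ^ m) / fact (2 * m + 1) -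
      (- 1) ^ m / fact (2 * m + 1) * lucas_U pi 1 (2 * m + 1)"
    by (simp add: right_diff_distrib diff_divide_distrib del: fact_Suc lucas_U.simps)
  also have "(- 1) ^ m * (- 1) ^ m = (1 :: real)"
    by (simp flip: power_mult_distrib)
  finally show ?thesis .
qed

lemma series_term_sums_sinh_1: "series_term sums sinh 1"
proof -
  have "2\<^sup>2 < pi\<^sup>2"
    using pi_ge_three by (intro power_strict_mono) auto
  then have "(\<lambda>m. 1 ^ (2 * m + 1) / fact (2 * m + 1) -
      (- 1) ^ m / fact (2 * m + 1) * lucas_U pi 1 (2 * m + 1)) sums (sinh 1 - 0)"
    by (intro sums_diff sinh_paired lucas_U_pi_sums_0) simp
  then show ?thesis
    by (simp only: power_one diff_zero flip: series_term_eq)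
qed

theorem theorem3:
  shows "(\<lambda>n. series_term (Suc n)) sums ((exp 1 - 1 / exp 1) / 2)
    \<and> series_term 1 = pi ^ 2 / fact 3
    \<and> series_term 2 = - ((pi ^ 4 - 3 * pi ^ 2) / fact 5)
    \<and> series_term 3 = (pi ^ 6 - 5 * pi ^ 4 + 6 * pi ^ 2) / fact 7
    \<and> series_term 4 = - ((pi ^ 8 - 7 * pi ^ 6 + 15 * pi ^ 4 - 10 * pi ^ 2) / fact 9)"
proof (intro conjI)
  have "series_term 0 = 0"
    by (simp add: series_term_def)
  then have "(\<lambda>n. series_term (Suc n)) sums sinh 1"
    using series_term_sums_sinh_1 by (subst sums_Suc_iff) simp
  then show "(\<lambda>n. series_term (Suc n)) sums ((exp 1 - 1 / exp 1) / 2)"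
    by (simp add: sinh_field_def exp_minus inverse_eq_divide)
  have "5 choose 3 = (10 :: nat)"
    by (simp add: eval_nat_numeral)
  then show "series_term 1 = pi ^ 2 / fact 3"
    and "series_term 2 = - ((pi ^ 4 - 3 * pi ^ 2) / fact 5)"
    and "series_term 3 = (pi ^ 6 - 5 * pi ^ 4 + 6 * pi ^ 2) / fact 7"
    and "series_term 4 = - ((pi ^ 8 - 7 * pi ^ 6 + 15 * pi ^ 4 - 10 * pi ^ 2) / fact 9)"
    by (simp_all add: series_term_def atLeastLessThan_nat_numeral choose_two)
qed

end
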